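(* Let \[ (p,r,m)\in\{(5,3,2),\ (7,5,3),\ (11,10,5),\ (17,3,9),\ (19,5,10),\ (23,10,12),\ (29,20,15)\}, \] and let $s$ be an integer with $0\le s<p$ and $s\neq m$. Then for all integers $n\ge0$ and $k\ge1$, we have \[ \mathcal{EO}_u\left( 4 p^{2k}n+4 p^{2k-1}s+ \frac{4 p^{2 k} r+4 p^{2 k-1}m+2 p^2-4 p m-4 r-2}{p^2-1}\right) \equiv 0 \pmod{4}. \]
   Context: For a positive integer $k$, let $f_k:=(q^k;q^k)_\infty=\prod_{i=1}^\infty(1-q^{ki})$. The integers $\mathcal{EO}_u(n)$, $n\ge 0$, are defined by $\sum_{n=0}^\infty \mathcal{EO}_u(n)q^n=\dfrac{f_4^2}{f_2^2}$. *)

theory Defs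
  imports
    "HOL-Analysis.Infinite_Products"
    "HOL-Computational_Algebra.Formal_Power_Series"
    "HOL-Number_Theory.Cong"
begin

text \<open>
  Everything is done with formal power series in $q$ = \<^const>\<open>fps_X\<close> over the integers.
  Infinite products converge in the $q$-adic topology of \<^typ>\<open>int fps\<close>; their index starts
  at 0, whence the shift \<^term>\<open>Suc i\<close>.
\<close>

definition euler_f :: "nat \<Rightarrow> int fps" where
  "euler_f k = (\<Prod>i. 1 - fps_X ^ (k * Suc i))"

text \<open>
  Division of power series is available only over coefficient types with an inverse, so the quotient
  $f_4^2 / f_2^2$ over the integers is written with the multiplicative inverse of $f_2^2$, a series
  with constant term 1. The lemma \<open>EO_u_gf_unique\<close> below confirms that this is the quotient.
\<close>

definition EO_u_gf :: "int fps" where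
  "EO_u_gf = euler_f 4 ^ 2 * fps_right_inverse (euler_f 2 ^ 2) 1"

definition EO_u :: "nat \<Rightarrow> int" where
  "EO_u n = fps_nth EO_u_gf n"

lemma euler_f_has_prod:
  assumes "k > 0"
  shows "(\<lambda>i. 1 - fps_X ^ (k * Suc i)) has_prod euler_f k"
    and "fps_nth (euler_f k) 0 = 1"
proof -
  define P :: "nat \<Rightarrow> int fps" where "P = (\<lambda>N. \<Prod>i\<le>N. 1 - fps_X ^ (k * Suc i))"
  define L where "L = Abs_fps (\<lambda>n. fps_nth (P n) n)"
  have stable: "fps_nth (P N) n = fps_nth (P n) n" if "N \<ge> n" for N n
    using that
  proof (induction N rule: dec_induct)
    case (step M)
    have "n < 1 * Suc (Suc M)"
      using step.hyps by simp
    also have "\<dots> \<le> k * Suc (Suc M)"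
      using assms by (intro mult_le_mono1) simp
    finally have "n < k * Suc (Suc M)" .
    moreover have "P (Suc M) = P M - P M * fps_X ^ (k * Suc (Suc M))"
      unfolding P_def prod.atMost_Suc by (simp only: right_diff_distrib mult_1_right)
    ultimately show ?case
      using step.IH by (simp only: fps_sub_nth fps_X_power_mult_right_nth if_True diff_zero)
  qed auto
  have lim: "P \<longlonglongrightarrow> L"
  proof (rule tendsto_fpsI)
    show "\<forall>\<^sub>F N in sequentially. fps_nth (P N) n = fps_nth L n" for n
      using eventually_ge_at_top[of n]
      by eventually_elim (unfold L_def fps_nth_Abs_fps, rule stable)
  qed
  have L0: "fps_nth L 0 = 1"
    using assms by (simp add: L_def P_def power_0_left)
  hence "L \<noteq> 0"
    by auto
  with lim have *: "(\<lambda>i. 1 - fps_X ^ (k * Suc i)) has_prod L"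
    by (simp add: has_prod_def raw_has_prod_def P_def)
  moreover from * have "euler_f k = L"
    unfolding euler_f_def by (rule has_prod_unique[symmetric])
  ultimately show "(\<lambda>i. 1 - fps_X ^ (k * Suc i)) has_prod euler_f k"
    and "fps_nth (euler_f k) 0 = 1"
    using L0 by simp_all
qed

lemma EO_u_gf_unique: "G * euler_f 2 ^ 2 = euler_f 4 ^ 2 \<longleftrightarrow> G = EO_u_gf"
proof -
  have f0: "fps_nth (euler_f 2 ^ 2) 0 = 1"
    by (simp add: fps_nth_power_0 euler_f_has_prod(2))
  hence nz: "euler_f 2 ^ 2 \<noteq> 0"
    by auto
  have "euler_f 2 ^ 2 * fps_right_inverse (euler_f 2 ^ 2) 1 = 1"
    by (rule fps_right_inverse) (simp add: f0)
  hence "EO_u_gf * euler_f 2 ^ 2 = euler_f 4 ^ 2"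
    unfolding EO_u_gf_def by (metis mult.assoc mult.commute mult_1_right)
  thus ?thesis
    using mult_right_cancel[OF nz, of G EO_u_gf] by simp
qed

end

theory Submission
  imports Defs "HOL-Number_Theory.Residues"
begin

text \<open>
  From \<open>1 + x = (1 - x) (1 + 2 x / (1 - x))\<close> one gets
  \<open>f\<^sub>4 \<equiv> f\<^sub>2\<^sup>2 (1 + 2 \<Sum>\<^sub>n d(n) q^(2 n))\<close> modulo 4, where \<open>d(n)\<close> counts divisors and is odd
  exactly at the squares. So \<open>f\<^sub>4\<^sup>2 / f\<^sub>2\<^sup>2 \<equiv> f\<^sub>4 (1 + 2 \<Sum> q^(2 j^2))\<close>, with \<open>j > 0\<close>, and the
  pentagonal number theorem for \<open>f\<^sub>4\<close> shows that \<open>EO\<^sub>u(4L + 2)\<close> is congruent modulo 4 to twice the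
  number of representations \<open>24 L + 13 = a\<^sup>2 + 3 b\<^sup>2\<close> with \<open>a, b > 0\<close>. On the given progressions
  \<open>p\<close> divides \<open>24 L + 13\<close> to an odd power. If \<open>p \<equiv> 2\<close> modulo 3, then \<open>p\<close> is inert in
  \<open>\<rat>(\<surd>-3)\<close> and there is no representation. For \<open>p = 7, 19\<close>, which split, the total number \<open>R\<close> of
  representations satisfies \<open>R(p M) + R(M / p) = 2 R(M)\<close>, and as \<open>R\<close> is always divisible by 4 away
  from degenerate representations, it is divisible by 8 here.
\<close>

section \<open>The pentagonal number theorem\<close>

text \<open>Lets congruences between series be treated as divisibility by a constant in the ring of
  series.\<close>

lemma fps_const_dvd_iff:
  fixes F :: "'a::comm_ring_1 fps"
  shows "fps_const c dvd F \<longleftrightarrow> (\<forall>n. c dvd fps_nth F n)"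
proof
  assume "\<forall>n. c dvd fps_nth F n"
  then obtain g where "\<And>n. fps_nth F n = c * g n"
    unfolding dvd_def by metis
  then have "F = fps_const c * Abs_fps g"
    by (simp add: fps_eq_iff)
  then show "fps_const c dvd F" ..
qed (auto elim!: dvdE)

lemma fps_mult_nth_cong:
  assumes "\<And>i. i \<le> n \<Longrightarrow> fps_nth f i = fps_nth f' i"
    and "\<And>i. i \<le> n \<Longrightarrow> fps_nth g i = fps_nth g' i"
  shows "fps_nth (f * g) n = fps_nth (f' * g') n"
  unfolding fps_mult_nth using assms by (intro sum.cong) auto

text \<open>Factors of index above \<open>n\<close> are 1 up to terms of degree above
  \<open>n\<close>, so coefficients stabilise and later work needs only finite products.\<close>

lemma euler_f_nth_eq:
  assumes "k > 0" "n \<le> N"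
  shows "fps_nth (euler_f k) n = fps_nth (\<Prod>i=1..N. 1 - fps_X ^ (k * i)) n"
proof -
  define P :: "nat \<Rightarrow> int fps" where "P = (\<lambda>N. \<Prod>i=1..N. 1 - fps_X ^ (k * i))"
  have stable: "fps_nth (P M) n = fps_nth (P n) n" if "n \<le> M" for M
    using that
  proof (induction M rule: dec_induct)
    case (step M)
    have "n < 1 * Suc M"
      using step.hyps by simp
    also have "\<dots> \<le> k * Suc M"
      using assms by (intro mult_le_mono1) simp
    finally have "n < k * Suc M" .
    moreover have "P (Suc M) = P M - P M * fps_X ^ (k * Suc M)"
      by (simp add: P_def algebra_simps)
    ultimately show ?case
      using step.IH by (simp only: fps_sub_nth fps_X_power_mult_right_nth if_True diff_zero)
  qed simp
  \<comment> \<open>The factors of \<open>euler_f\<close> are indexed from 0, those of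
    \<open>P\<close> from 1.\<close>
  have P_Suc: "P (Suc M) = (\<Prod>i\<le>M. 1 - fps_X ^ (k * Suc i))" for M
    unfolding P_def using prod.atLeast_Suc_atMost_Suc_shift[of "\<lambda>i. 1 - fps_X ^ (k * i)" 0 M]
    by (simp add: atMost_atLeast0)
  have "(\<lambda>M. \<Prod>i\<le>M. 1 - fps_X ^ (k * Suc i)) \<longlonglongrightarrow> euler_f k"
    using euler_f_has_prod(1)[OF assms(1)] by (rule has_prod_imp_tendsto)
  then have "eventually (\<lambda>M. fps_nth (P (Suc M)) n = fps_nth (euler_f k) n) sequentially"
    unfolding P_Suc tendsto_fps_iff by blast
  then obtain M where "M \<ge> n" "fps_nth (P (Suc M)) n = fps_nth (euler_f k) n"
    unfolding eventually_sequentially by (meson nat_le_linear)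
  then show ?thesis
    using stable[of "Suc M"] stable[of N] assms by (simp add: P_def)
qed

text \<open>Shanks' finite form; the variable is a square \<open>y\<^sup>2\<close> so that no exponent has to be halved.\<close>

lemma finite_pentagonal:
  fixes y :: "'a::comm_ring_1"
  shows "(\<Sum>k = - int N..int N. (-1) ^ nat \<bar>k\<bar> * y ^ nat (k * (3 * k + 1))) =
    (\<Sum>k\<le>N. (-1) ^ k * (\<Prod>i=Suc k..N. 1 - y ^ (2 * i)) * y ^ (2 * k * N + k * (k + 1)))"
proof (induction N)
  case (Suc N)
  define P where "P = (\<lambda>k. \<Prod>i=Suc k..N. 1 - y ^ (2 * i))"
  \<comment> \<open>Telescoping term: passing from \<open>N\<close> to \<open>Suc N\<close> changes
    summand \<open>k\<close> by \<open>A (k - 1) - A k\<close>, the first part being 0 at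
    \<open>k = 0\<close>.\<close>
  define A where "A = (\<lambda>k. (-1) ^ k * P k * y ^ (2 * (k + 1) * Suc N + k * (k + 1)))"
  have P_step: "P k = (1 - y ^ (2 * Suc k)) * P (Suc k)" if "k < N" for k
    unfolding P_def using that by (subst prod.atLeast_Suc_atMost) auto
  have diff: "(-1) ^ k * (P k * (1 - y ^ (2 * Suc N))) * y ^ (2 * k * Suc N + k * (k + 1))
        - (-1) ^ k * P k * y ^ (2 * k * N + k * (k + 1))
      = (if k = 0 then 0 else A (k - 1)) - A k" if "k \<le> N" for k
  proof (cases k)
    case 0
    then show ?thesis
      by (simp add: A_def algebra_simps)
  next
    case (Suc j)
    define z where "z = y ^ (2 * k * N + k * (k + 1))"
    have e1: "y ^ (2 * k * Suc N + k * (k + 1)) = z * y ^ (2 * k)"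
      by (simp add: z_def power_add [symmetric] algebra_simps)
    have e2: "y ^ (2 * (k + 1) * Suc N + k * (k + 1)) = z * y ^ (2 * k) * y ^ (2 * Suc N)"
      by (simp add: z_def power_add [symmetric] algebra_simps)
    have e3: "y ^ (2 * (j + 1) * Suc N + j * (j + 1)) = z"
      by (simp add: z_def Suc algebra_simps)
    have "P j = (1 - y ^ (2 * k)) * P k"
      using P_step[of j] that Suc by simp
    then have "A j = - ((-1) ^ k * (1 - y ^ (2 * k)) * P k * z)"
      unfolding A_def e3 by (simp add: Suc)
    moreover have "A k = (-1) ^ k * P k * (z * y ^ (2 * k) * y ^ (2 * Suc N))"
      unfolding A_def e2 ..
    ultimately show ?thesis
      unfolding e1 z_def[symmetric] using Suc by (simp add: algebra_simps del: power_Suc)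
  qed
  have tele: "(\<Sum>k\<le>N. (if k = 0 then 0 else A (k - 1)) - A k) = - A N"
    by (induction N) auto
  have split: "{- int (Suc N)..int (Suc N)} = insert (- int (Suc N)) (insert (int (Suc N)) {- int N..int N})"
    by auto
  \<comment> \<open>\<open>E\<close> belongs to the index \<open>Suc N\<close> and matches the new
    last summand on the right; \<open>E'\<close> belongs to \<open>- Suc N\<close> and matches the
    leftover \<open>- A N\<close>.\<close>
  define E where "E = y ^ (2 * Suc N * Suc N + Suc N * (Suc N + 1))"
  define E' where "E' = y ^ (2 * (N + 1) * Suc N + N * (N + 1))"
  have "nat (int (Suc N) * (3 * int (Suc N) + 1)) = 2 * Suc N * Suc N + Suc N * (Suc N + 1)"
    by (simp add: nat_eq_iff algebra_simps)
  then have n1: "y ^ nat (int (Suc N) * (3 * int (Suc N) + 1)) = E"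
    by (simp only: E_def)
  have "nat (- int (Suc N) * (3 * - int (Suc N) + 1)) = 2 * (N + 1) * Suc N + N * (N + 1)"
    by (simp add: nat_eq_iff algebra_simps)
  then have n2: "y ^ nat (- int (Suc N) * (3 * - int (Suc N) + 1)) = E'"
    by (simp only: E'_def)
  have n3: "nat \<bar>int (Suc N)\<bar> = Suc N" "nat \<bar>- int (Suc N)\<bar> = Suc N"
    by simp_all
  have "(\<Sum>k\<le>Suc N. (-1) ^ k * (\<Prod>i=Suc k..Suc N. 1 - y ^ (2 * i)) * y ^ (2 * k * Suc N + k * (k + 1)))
      = (\<Sum>k\<le>N. (-1) ^ k * (P k * (1 - y ^ (2 * Suc N))) * y ^ (2 * k * Suc N + k * (k + 1)))
        + (-1) ^ Suc N * E"
    unfolding sum.atMost_Suc E_def P_def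
    by (intro arg_cong2[where f = "(+)"] sum.cong refl) (simp_all add: prod.nat_ivl_Suc')
  also have "(\<Sum>k\<le>N. (-1) ^ k * (P k * (1 - y ^ (2 * Suc N))) * y ^ (2 * k * Suc N + k * (k + 1)))
      = (\<Sum>k\<le>N. (-1) ^ k * P k * y ^ (2 * k * N + k * (k + 1))) - A N"
    unfolding tele[symmetric] diff_conv_add_uminus[of _ "A N"]
    unfolding sum.distrib[symmetric]
    by (intro sum.cong refl) (use diff in \<open>simp add: algebra_simps\<close>)
  also have "A N = (-1) ^ N * E'"
    by (simp add: A_def P_def E'_def)
  finally show ?case
    unfolding split using Suc.IH
    by (subst sum.insert, simp, simp, subst sum.insert, simp, simp)
       (simp only: n1 n2 n3 P_def, simp)
qed simp

text \<open>Put \<open>y = q^m\<close> in the finite identity: all summands but \<open>k = 0\<close>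
  start in degree at least \<open>m * (2 * N + 2) > e\<close>. The index \<open>2 * m\<close> is
  even since the identity runs in \<open>y^2\<close>.\<close>

lemma euler_f_even_nth:
  assumes "m > 0" "e \<le> N"
  shows "fps_nth (euler_f (2 * m)) e =
    (\<Sum>k = - int N..int N. (-1) ^ nat \<bar>k\<bar> * of_bool (e = m * nat (k * (3 * k + 1))))"
proof -
  let ?y = "fps_X ^ m :: int fps"
  let ?P = "\<lambda>k. \<Prod>i=Suc k..N. 1 - ?y ^ (2 * i)"
  have zero: "fps_nth ((-1) ^ k * ?P k * ?y ^ (2 * k * N + k * (k + 1))) e = 0" if "k \<noteq> 0" for k
  proof -
    have "e < 1 * (2 * 1 * N + 1 * (1 + 1))"
      using assms by simp
    also have "\<dots> \<le> m * (2 * k * N + k * (k + 1))"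
      using assms that by (intro mult_le_mono add_le_mono) auto
    finally show ?thesis
      by (simp only: power_mult[symmetric] fps_X_power_mult_right_nth if_True)
  qed
  have "fps_nth (euler_f (2 * m)) e = fps_nth (?P 0) e"
    using euler_f_nth_eq[of "2 * m" e N] assms
    by (simp add: power_mult[symmetric] mult_ac)
  also have "\<dots> = fps_nth (\<Sum>k\<le>N. (-1) ^ k * ?P k * ?y ^ (2 * k * N + k * (k + 1))) e"
    unfolding fps_sum_nth using zero by (subst sum.remove[of _ 0]) auto
  also have "\<dots> = (\<Sum>k = - int N..int N. (-1) ^ nat \<bar>k\<bar> * of_bool (e = m * nat (k * (3 * k + 1))))"
    unfolding finite_pentagonal[symmetric] fps_sum_nth
  proof (rule sum.cong[OF refl])
    fix k :: int
    have "fps_nth ((-1) ^ nat \<bar>k\<bar> * ?y ^ nat (k * (3 * k + 1))) e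
        = fps_nth (fps_const ((-1) ^ nat \<bar>k\<bar>) * fps_X ^ (m * nat (k * (3 * k + 1)))) e"
      by (simp add: power_mult fps_const_power[symmetric] fps_const_neg[symmetric] del: fps_const_neg fps_const_power)
    then show "fps_nth ((-1) ^ nat \<bar>k\<bar> * ?y ^ nat (k * (3 * k + 1))) e
        = (-1) ^ nat \<bar>k\<bar> * of_bool (e = m * nat (k * (3 * k + 1)))"
      by (simp del: fps_const_neg fps_const_power)
  qed
  finally show ?thesis .
qed

text \<open>Confines the \<open>k\<close> that contribute to a given exponent to a finite symmetric
  range.\<close>

lemma pentagonal_bounds:
  fixes k :: int
  shows "0 \<le> k * (3 * k + 1)" and "\<bar>k\<bar> \<le> k * (3 * k + 1)"
proof -
  show "\<bar>k\<bar> \<le> k * (3 * k + 1)"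
  proof (cases "k \<ge> 0")
    case True
    then have "k * 1 \<le> k * (3 * k + 1)"
      by (intro mult_left_mono) auto
    with True show ?thesis by simp
  next
    case False
    then have "(- k) * 1 \<le> (- k) * (- (3 * k + 1))"
      by (intro mult_left_mono) auto
    with False show ?thesis by (simp add: algebra_simps)
  qed
  then show "0 \<le> k * (3 * k + 1)" by linarith
qed

text \<open>Signs disappear modulo 2, so the pentagonal number theorem becomes a count.\<close>

lemma euler_f_even_nth_cong_2:
  assumes "m > 0"
  shows "[fps_nth (euler_f (2 * m)) e = int (card {k::int. int e = int m * (k * (3 * k + 1))})] (mod 2)"
proof -
  let ?Q = "\<lambda>k. e = m * nat (k * (3 * k + 1))"
  have Q: "?Q k \<longleftrightarrow> int e = int m * (k * (3 * k + 1))" for k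
    using pentagonal_bounds(1)[of k] by (metis int_nat_eq of_nat_eq_iff of_nat_mult)
  have bd: "k \<in> {- int e..int e}" if "?Q k" for k
  proof -
    have "\<bar>k\<bar> \<le> 1 * (k * (3 * k + 1))"
      using pentagonal_bounds(2) by simp
    also have "\<dots> \<le> int m * (k * (3 * k + 1))"
      using assms pentagonal_bounds(1)[of k] by (intro mult_right_mono) auto
    finally show ?thesis
      using that Q by auto
  qed
  have "[(\<Sum>k = - int e..int e. (-1) ^ nat \<bar>k\<bar> * of_bool (?Q k) :: int) = (\<Sum>k = - int e..int e. of_bool (?Q k))] (mod 2)"
    by (rule cong_sum) (auto simp: cong_def minus_one_power_iff)
  also have "(\<Sum>k = - int e..int e. of_bool (?Q k) :: int) = int (card ({- int e..int e} \<inter> {k. ?Q k}))"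
    by simp
  also have "{- int e..int e} \<inter> {k. ?Q k} = {k. int e = int m * (k * (3 * k + 1))}"
    using bd Q by blast
  finally show ?thesis
    using euler_f_even_nth[OF assms order_refl, of e] by simp
qed

section \<open>The generating function modulo 4\<close>

text \<open>The involution \<open>d \<mapsto> n div d\<close> pairs divisors below the square root
  with those above; only the root itself can be fixed.\<close>

lemma odd_card_divisors_iff:
  fixes n :: nat
  assumes "n > 0"
  shows "odd (card {d. d dvd n}) \<longleftrightarrow> (\<exists>j. n = j ^ 2)"
proof -
  let ?S = "{d. d dvd n \<and> d * d < n}" and ?L = "{d. d dvd n \<and> n < d * d}" and ?E = "{d. d dvd n \<and> d * d = n}"
  have fin: "finite {d. d dvd n}"
    using assms by simp
  have "bij_betw (\<lambda>d. n div d) ?S ?L"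
  proof (rule bij_betw_byWitness[where f' = "\<lambda>d. n div d"])
    have *: "n div d dvd n" "d * (n div d) = n" "n div (n div d) = d" "d > 0" if "d dvd n" for d
      using that assms by (auto elim!: dvdE)
    have lt: "n < (n div d) * (n div d) \<longleftrightarrow> d * d < n" if "d dvd n" for d
    proof -
      have "n < (n div d) * (n div d) \<longleftrightarrow> d < n div d"
        using *[OF that] assms by (metis mult_less_cancel2 div_greater_zero_iff dvd_imp_le gr0I mult_is_0)
      also have "\<dots> \<longleftrightarrow> d * d < n"
        using *[OF that] by (metis mult_less_cancel1)
      finally show ?thesis .
    qed
    show "(\<lambda>d. n div d) ` ?S \<subseteq> ?L"
      using *(1) lt by auto
    show "(\<lambda>d. n div d) ` ?L \<subseteq> ?S"
    proof clarify
      fix d assume d: "d dvd n" "n < d * d"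
      then show "n div d dvd n \<and> (n div d) * (n div d) < n"
        using lt[OF *(1)[OF d(1)]] *(1)[OF d(1)] by (simp add: *(3)[OF d(1)])
    qed
  qed (use assms in \<open>auto elim!: dvdE\<close>)
  then have "card ?S = card ?L"
    by (rule bij_betw_same_card)
  moreover have "{d. d dvd n} = (?S \<union> ?L) \<union> ?E"
    by auto
  then have "card {d. d dvd n} = card ((?S \<union> ?L) \<union> ?E)"
    by (rule arg_cong)
  moreover have "card ((?S \<union> ?L) \<union> ?E) = card (?S \<union> ?L) + card ?E"
    by (intro card_Un_disjoint) (auto intro: finite_subset[OF _ fin])
  moreover have "card (?S \<union> ?L) = card ?S + card ?L"
    using fin by (intro card_Un_disjoint) (auto intro: finite_subset[OF _ fin])
  moreover have "card ?E = of_bool (\<exists>j. n = j ^ 2)"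
  proof (cases "\<exists>j. n = j ^ 2")
    case True
    then obtain j where j: "n = j ^ 2" by blast
    have "d * d = n \<longleftrightarrow> d = j" for d
      unfolding j power2_eq_square[symmetric] by (simp only: power2_eq_iff_nonneg zero_le)
    then have "?E = {j}"
      unfolding j by auto
    with True show ?thesis by simp
  next
    case False
    then have "?E = {}"
      unfolding power2_eq_square by blast
    then have "card ?E = 0"
      by (simp only: card.empty)
    with False show ?thesis by simp
  qed
  ultimately show ?thesis
    by simp
qed

text \<open>The series \<open>q^d / (1 - q^d)\<close>, written without division.\<close>

definition multiples_gf :: "nat \<Rightarrow> int fps" where
  "multiples_gf d = Abs_fps (\<lambda>n. of_bool (n > 0 \<and> d dvd n))"

text \<open>For \<open>k > 0\<close> this is the Lambert series, the sum of
  \<open>q^(k i) / (1 - q^(k i))\<close> over \<open>i > 0\<close>.\<close>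

definition divisors_gf :: "nat \<Rightarrow> int fps" where
  "divisors_gf k = Abs_fps (\<lambda>n. if n = 0 then 0 else int (card {i. k * i dvd n}))"

text \<open>A positive multiple of \<open>d\<close> is either \<open>d\<close> or \<open>d\<close>
  plus a smaller positive multiple.\<close>

lemma multiples_gf_mult:
  assumes "d > 0"
  shows "(1 - fps_X ^ d) * (1 + 2 * multiples_gf d) = 1 + fps_X ^ d"
proof -
  have "multiples_gf d = fps_X ^ d + multiples_gf d * fps_X ^ d"
    using assms
    by (intro fps_ext) (auto simp: multiples_gf_def fps_X_power_mult_right_nth dvd_imp_le dvd_minus_self not_less)
  then have "(1 - fps_X ^ d) * multiples_gf d = fps_X ^ d"
    by (simp add: algebra_simps)
  then show ?thesis
    by (simp add: distrib_left mult.left_commute[of _ 2])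
qed

lemma sum_multiples_gf_nth:
  assumes "k > 0" "n \<le> N"
  shows "fps_nth (\<Sum>i=1..N. multiples_gf (k * i)) n = fps_nth (divisors_gf k) n"
proof (cases "n = 0")
  case False
  have "{1..N} \<inter> {i. k * i dvd n} = {i. k * i dvd n}"
  proof -
    have "1 \<le> i \<and> i \<le> N" if "k * i dvd n" for i
      using dvd_imp_le[of i n] that False assms by (cases "i = 0") (auto dest: dvd_mult_right)
    then show ?thesis by auto
  qed
  then show ?thesis
    using False by (simp add: fps_sum_nth multiples_gf_def divisors_gf_def)
qed (simp add: fps_sum_nth multiples_gf_def divisors_gf_def)

lemma four_dvd_fps_iff: "4 dvd F \<longleftrightarrow> (\<forall>n. 4 dvd fps_nth F n)" for F :: "'a::comm_ring_1 fps"
  unfolding fps_numeral_fps_const by (rule fps_const_dvd_iff)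

text \<open>Every term of the expansion that uses two or more of the \<open>2 * h i\<close> is
  divisible by 4.\<close>

lemma prod_one_plus_two_mod_4:
  fixes h :: "'b \<Rightarrow> 'a::comm_ring_1"
  assumes "finite A"
  shows "4 dvd (\<Prod>i\<in>A. 1 + 2 * h i) - (1 + 2 * (\<Sum>i\<in>A. h i))"
  using assms
proof (induction A rule: finite_induct)
  case (insert x A)
  then obtain z where "(\<Prod>i\<in>A. 1 + 2 * h i) = 1 + 2 * (\<Sum>i\<in>A. h i) + 4 * z"
    by (metis dvdE add_diff_cancel_left' diff_add_cancel add.commute)
  then have "(\<Prod>i\<in>insert x A. 1 + 2 * h i) - (1 + 2 * (\<Sum>i\<in>insert x A. h i))
      = 4 * (z + h x * (\<Sum>i\<in>A. h i) + 2 * h x * z)"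
    using insert.hyps by (simp add: algebra_simps)
  then show ?case
    by (simp only: dvd_triv_left)
qed simp

text \<open>Each factor satisfies \<open>1 - x\<^sup>2 = (1 - x)\<^sup>2 (1 + 2 x / (1 - x))\<close>, and modulo 4 the product of
  the factors \<open>1 + 2 x / (1 - x)\<close> linearises.\<close>

lemma euler_f_double_mod_4:
  assumes "k > 0"
  shows "4 dvd euler_f (2 * k) - euler_f k ^ 2 * (1 + 2 * divisors_gf k)"
proof -
  have "4 dvd fps_nth (euler_f (2 * k) - euler_f k ^ 2 * (1 + 2 * divisors_gf k)) n" for n
  proof -
    \<comment> \<open>For coefficient \<open>n\<close>, the products and the Lambert series can be
      cut off after index \<open>n\<close>.\<close>
    let ?P = "\<Prod>i=1..n. 1 - fps_X ^ (k * i) :: int fps"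
    let ?h = "\<lambda>i. multiples_gf (k * i)"
    have "(\<Prod>i=1..n. 1 - fps_X ^ (2 * k * i) :: int fps) = (\<Prod>i=1..n. (1 - fps_X ^ (k * i)) ^ 2 * (1 + 2 * ?h i))"
    proof (rule prod.cong[OF refl])
      fix i assume "i \<in> {1..n}"
      then have "k * i > 0" using assms by simp
      then have "(1 - fps_X ^ (k * i)) ^ 2 * (1 + 2 * ?h i) = (1 - fps_X ^ (k * i)) * (1 + fps_X ^ (k * i))"
        by (simp only: power2_eq_square mult.assoc multiples_gf_mult)
      also have "\<dots> = 1 - fps_X ^ (2 * k * i)"
        by (simp add: mult_2 distrib_right power_add) (simp add: algebra_simps)
      finally show "1 - fps_X ^ (2 * k * i) = (1 - fps_X ^ (k * i)) ^ 2 * (1 + 2 * ?h i)" ..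
    qed
    then have eq: "(\<Prod>i=1..n. 1 - fps_X ^ (2 * k * i) :: int fps) = ?P ^ 2 * (\<Prod>i=1..n. 1 + 2 * ?h i)"
      by (simp add: prod.distrib prod_power_distrib)
    have "4 dvd ?P ^ 2 * ((\<Prod>i=1..n. 1 + 2 * ?h i) - (1 + 2 * (\<Sum>i=1..n. ?h i)))"
      by (intro dvd_mult prod_one_plus_two_mod_4) simp
    then have "4 dvd (\<Prod>i=1..n. 1 - fps_X ^ (2 * k * i)) - ?P ^ 2 * (1 + 2 * (\<Sum>i=1..n. ?h i))"
      unfolding eq by (simp add: algebra_simps)
    then have "4 dvd fps_nth ((\<Prod>i=1..n. 1 - fps_X ^ (2 * k * i)) - ?P ^ 2 * (1 + 2 * (\<Sum>i=1..n. ?h i))) n"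
      unfolding four_dvd_fps_iff by blast
    moreover have "fps_nth (?P ^ 2 * (1 + 2 * (\<Sum>i=1..n. ?h i))) n = fps_nth (euler_f k ^ 2 * (1 + 2 * divisors_gf k)) n"
    proof -
      have f: "fps_nth ?P i = fps_nth (euler_f k) i" if "i \<le> n" for i
        using euler_f_nth_eq[OF assms that] by simp
      have g: "fps_nth (1 + 2 * (\<Sum>i=1..n. ?h i)) i = fps_nth (1 + 2 * divisors_gf k) i" if "i \<le> n" for i
        using sum_multiples_gf_nth[OF assms that] by (simp add: fps_numeral_fps_const)
      show ?thesis
        unfolding power2_eq_square by (intro fps_mult_nth_cong f g) auto
    qed
    moreover have "fps_nth (euler_f (2 * k)) n = fps_nth (\<Prod>i=1..n. 1 - fps_X ^ (2 * k * i)) n"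
      using assms by (intro euler_f_nth_eq) simp_all
    ultimately show ?thesis
      by (simp only: fps_sub_nth)
  qed
  then show ?thesis
    unfolding four_dvd_fps_iff by blast
qed

lemma EO_u_gf_mod_4: "4 dvd EO_u_gf - euler_f 4 * (1 + 2 * divisors_gf 2)"
proof -
  let ?I = "fps_right_inverse (euler_f 2 ^ 2) 1"
  have inv: "euler_f 2 ^ 2 * ?I = 1"
    by (rule fps_right_inverse) (simp add: fps_nth_power_0 euler_f_has_prod(2))
  \<comment> \<open>The second summand vanishes by \<open>inv\<close>; including it makes the
    equation a plain ring identity.\<close>
  have "EO_u_gf - euler_f 4 * (1 + 2 * divisors_gf 2)
      = euler_f 4 * ?I * (euler_f 4 - euler_f 2 ^ 2 * (1 + 2 * divisors_gf 2))
        + (euler_f 2 ^ 2 * ?I - 1) * (euler_f 4 * (1 + 2 * divisors_gf 2))"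
    by (simp add: EO_u_gf_def power2_eq_square algebra_simps)
  then show ?thesis
    using euler_f_double_mod_4[of 2] inv by simp
qed

text \<open>At \<open>n = 2 * h > 0\<close> the coefficient is the number of divisors of
  \<open>h\<close>; at odd \<open>n\<close> it is 0.\<close>

lemma divisors_gf_2_nth_cong_2:
  "[fps_nth (divisors_gf 2) n = of_bool (n > 0 \<and> (\<exists>j. n = 2 * j ^ 2))] (mod 2)"
proof (cases "n > 0 \<and> even n")
  case True
  then obtain h where h: "n = 2 * h" "h > 0" by auto
  then have "fps_nth (divisors_gf 2) n = int (card {i. i dvd h})"
    by (simp add: divisors_gf_def)
  moreover have "(\<exists>j. n = 2 * j ^ 2) \<longleftrightarrow> (\<exists>j. h = j ^ 2)"
    using h by simp
  ultimately show ?thesis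
    using odd_card_divisors_iff[OF h(2)] h
    by (auto simp: cong_def mod_2_eq_odd)
next
  case False
  then have "{i. 2 * i dvd n} = {}" if "n > 0"
    using that by (auto dest: dvd_mult_left)
  with False show ?thesis
    by (auto simp: divisors_gf_def)
qed

section \<open>Representations by \<open>a\<^sup>2 + 3 b\<^sup>2\<close>\<close>

definition norm_reps :: "int \<Rightarrow> (int \<times> int) set" where
  "norm_reps M = {(a, b). a ^ 2 + 3 * b ^ 2 = M}"

definition pos_norm_reps :: "int \<Rightarrow> (int \<times> int) set" where
  "pos_norm_reps M = {(a, b). a ^ 2 + 3 * b ^ 2 = M \<and> a > 0 \<and> b > 0}"

lemma finite_norm_reps: "finite (norm_reps M)"
proof (rule finite_subset)
  show "norm_reps M \<subseteq> {- M..M} \<times> {- M..M}"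
  proof clarify
    fix a b assume "(a, b) \<in> norm_reps M"
    then have M: "a ^ 2 + 3 * b ^ 2 = M"
      by (simp add: norm_reps_def)
    have "\<bar>x\<bar> \<le> x ^ 2" for x :: int
    proof (cases "x = 0")
      case False
      then have "\<bar>x\<bar> * 1 \<le> \<bar>x\<bar> * \<bar>x\<bar>"
        by (intro mult_left_mono) auto
      then show ?thesis
        by (simp add: power2_eq_square)
    qed simp
    from this[of a] this[of b] M zero_le_power2[of a] zero_le_power2[of b]
    have "\<bar>a\<bar> \<le> M" "\<bar>b\<bar> \<le> M" by linarith+
    then show "a \<in> {- M..M} \<and> b \<in> {- M..M}" by auto
  qed
qed simp

text \<open>Neither coordinate can vanish, so the four sign changes act freely, with one positive
  pair in each orbit.\<close>

lemma card_norm_reps: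
  assumes "\<And>a. M \<noteq> a ^ 2" "\<And>b. M \<noteq> 3 * b ^ 2"
  shows "card (norm_reps M) = 4 * card (pos_norm_reps M)"
proof -
  let ?f = "\<lambda>((s, t), (a, b)). (s * a, t * b) :: int \<times> int"
  have "bij_betw ?f (({1, -1} \<times> {1, -1}) \<times> pos_norm_reps M) (norm_reps M)"
  proof (rule bij_betw_byWitness[where f' = "\<lambda>(a, b). ((sgn a, sgn b), (\<bar>a\<bar>, \<bar>b\<bar>))"])
    have nz: "a \<noteq> 0" "b \<noteq> 0" if "(a, b) \<in> norm_reps M" for a b
      using that assms(1)[of a] assms(2)[of b] by (auto simp: norm_reps_def)
    show "(\<lambda>(a, b). ((sgn a, sgn b), (\<bar>a\<bar>, \<bar>b\<bar>))) ` norm_reps M \<subseteq> ({1, -1} \<times> {1, -1}) \<times> pos_norm_reps M"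
      using nz by (fastforce simp: norm_reps_def pos_norm_reps_def sgn_if)
  qed (auto simp: norm_reps_def pos_norm_reps_def abs_mult sgn_mult mult_sgn_abs power_mult_distrib)
  then have "card (({1, -1 :: int} \<times> {1, -1 :: int}) \<times> pos_norm_reps M) = card (norm_reps M)"
    by (rule bij_betw_same_card)
  then show ?thesis
    by (simp add: card_cartesian_product)
qed

text \<open>Used in both the inert and the split case to lower the exponent of \<open>p\<close> by
  2.\<close>

lemma bij_betw_norm_reps_scale:
  assumes "p \<noteq> 0"
  shows "bij_betw (\<lambda>(a, b). (p * a, p * b)) (norm_reps M) {(a, b) \<in> norm_reps (p ^ 2 * M). p dvd a \<and> p dvd b}"
proof (rule bij_betw_byWitness[where f' = "\<lambda>(a, b). (a div p, b div p)"])
  have "(p * c) ^ 2 + 3 * (p * d) ^ 2 = p ^ 2 * M \<longleftrightarrow> c ^ 2 + 3 * d ^ 2 = M" for c d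
  proof -
    have "(p * c) ^ 2 + 3 * (p * d) ^ 2 = p ^ 2 * (c ^ 2 + 3 * d ^ 2)"
      by (simp add: power_mult_distrib algebra_simps)
    then show ?thesis using assms by simp
  qed
  then show "(\<lambda>(a, b). (p * a, p * b)) ` norm_reps M \<subseteq> {(a, b) \<in> norm_reps (p ^ 2 * M). p dvd a \<and> p dvd b}"
    and "(\<lambda>(a, b). (a div p, b div p)) ` {(a, b) \<in> norm_reps (p ^ 2 * M). p dvd a \<and> p dvd b} \<subseteq> norm_reps M"
    using assms by (auto simp: norm_reps_def elim!: dvdE)
qed (use assms in auto)

text \<open>Since 3 does not divide \<open>p - 1\<close>, cubing is injective on units modulo
  \<open>p\<close>, which rules out a nontrivial zero of the form
  \<open>x^2 + x y + y^2\<close>.\<close>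

lemma inert_dvd:
  fixes p :: nat and a b :: int
  assumes "prime p" "p mod 3 = 2" "p \<noteq> 2" and dvd: "int p dvd a ^ 2 + 3 * b ^ 2"
  shows "int p dvd a \<and> int p dvd b"
proof -
  have p: "prime (int p)" using assms by simp
  have not3: "\<not> int p dvd 3"
  proof
    assume "int p dvd 3"
    then have "p \<le> 3" using zdvd_imp_le[of "int p" 3] by simp
    then show False using assms(2,3) by presburger
  qed
  have b: "int p dvd b"
  proof (rule ccontr)
    assume nb: "\<not> int p dvd b"
    \<comment> \<open>This substitution turns \<open>a^2 + 3 b^2\<close> into
      \<open>x^2 + x y + y^2\<close>, a factor of \<open>x^3 - y^3\<close>.\<close>
    define x where "x = a + b"
    define y where "y = - 2 * b"
    define t where "t = p div 3"
    have t: "p = 3 * t + 2"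
      using assms(2) unfolding t_def by presburger
    have "\<not> int p dvd 2"
      using zdvd_imp_le[of "int p" 2] assms(2,3) by auto
    then have ny: "\<not> int p dvd y"
      using nb p by (auto simp: y_def prime_dvd_mult_iff)
    have xy: "x ^ 2 + x * y + y ^ 2 = a ^ 2 + 3 * b ^ 2"
      by (simp add: x_def y_def power2_eq_square algebra_simps)
    have nx: "\<not> int p dvd x"
    proof
      assume "int p dvd x"
      then have "int p dvd x ^ 2 + x * y"
        by (simp add: power2_eq_square)
      then have "int p dvd y ^ 2"
        using dvd unfolding xy[symmetric] by (simp add: dvd_add_right_iff)
      with ny p show False by (simp add: prime_dvd_power_iff)
    qed
    \<comment> \<open>As \<open>p - 1 = 3 * t + 1\<close>, the inverse of a unit is a power of its
      cube; hence equal cubes force \<open>x\<close> and \<open>y\<close> to agree modulo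
      \<open>p\<close>.\<close>
    have fermat: "[z ^ (3 * t) * z = 1] (mod int p)" if "\<not> int p dvd z" for z :: int
    proof -
      have "[z ^ (p - 1) = 1] (mod int p)"
      proof -
        have "coprime z (int p)"
          using that p by (metis coprime_commute prime_imp_coprime)
        moreover have "residues (int p)"
          using prime_gt_1_nat[OF assms(1)] by (simp add: residues_def)
        ultimately have "[z ^ totient p = 1] (mod int p)"
          using residues.euler_theorem by fastforce
        then show ?thesis using assms(1) by (simp add: totient_prime)
      qed
      also have "p - 1 = Suc (3 * t)" using t by simp
      finally show ?thesis by (simp add: mult.commute)
    qed
    have "x ^ 3 - y ^ 3 = (x - y) * (x ^ 2 + x * y + y ^ 2)"
      by (simp add: power2_eq_square power3_eq_cube algebra_simps)
    then have "[x ^ 3 = y ^ 3] (mod int p)"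
      using dvd xy by (simp add: cong_iff_dvd_diff)
    then have "[x ^ (3 * t) = y ^ (3 * t)] (mod int p)"
      by (simp add: power_mult cong_pow)
    then have "[x ^ (3 * t) * y = x ^ (3 * t) * x] (mod int p)"
      using fermat[OF nx] fermat[OF ny] by (meson cong_scalar_right cong_sym cong_trans)
    then have "int p dvd x ^ (3 * t) * (y - x)"
      by (simp add: cong_iff_dvd_diff algebra_simps)
    then have "int p dvd y - x"
      using nx p by (metis prime_dvd_mult_iff prime_dvd_power)
    then have "int p dvd (x ^ 2 + x * y + y ^ 2) + (y - x) * (x + 2 * y)"
      unfolding xy by (rule dvd_add[OF dvd dvd_mult2])
    also have "(x ^ 2 + x * y + y ^ 2) + (y - x) * (x + 2 * y) = 3 * y ^ 2"
      by (simp add: power2_eq_square algebra_simps)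
    finally show False
      using ny not3 p by (metis prime_dvd_mult_iff prime_dvd_power)
  qed
  moreover have "int p dvd a ^ 2"
    using dvd b by (simp add: dvd_add_left_iff power2_eq_square)
  ultimately show ?thesis
    using p by (metis prime_dvd_power)
qed

text \<open>Descent: \<open>p\<close> divides both coordinates, so \<open>p^2\<close> can be
  cancelled until the exponent is 1, where it would give \<open>p dvd M\<close>.\<close>

lemma norm_reps_inert:
  fixes p :: nat
  assumes "prime p" "p mod 3 = 2" "p \<noteq> 2" "\<not> int p dvd M"
  shows "norm_reps (int p ^ (2 * k + 1) * M) = {}"
proof (induction k)
  case 0
  show ?case
  proof (rule ccontr)
    assume "norm_reps (int p ^ (2 * 0 + 1) * M) \<noteq> {}"
    then obtain a b where ab: "a ^ 2 + 3 * b ^ 2 = int p * M"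
      by (auto simp: norm_reps_def)
    then have "int p dvd a \<and> int p dvd b"
      by (intro inert_dvd assms) simp
    then obtain c d where "a = int p * c" "b = int p * d" by (auto elim!: dvdE)
    with ab have "int p * M = int p * (int p * (c ^ 2 + 3 * d ^ 2))"
      by (simp add: power2_eq_square algebra_simps)
    then have "M = int p * (c ^ 2 + 3 * d ^ 2)"
      using assms(1) by (metis mult_left_cancel of_nat_0_eq_iff not_prime_0)
    with assms(4) show False by simp
  qed
next
  case (Suc k)
  have eq: "int p ^ (2 * Suc k + 1) * M = int p ^ 2 * (int p ^ (2 * k + 1) * M)"
    by (simp add: power2_eq_square)
  have "{(a, b) \<in> norm_reps (int p ^ 2 * (int p ^ (2 * k + 1) * M)). int p dvd a \<and> int p dvd b} = {}"
    using bij_betw_norm_reps_scale[of "int p" "int p ^ (2 * k + 1) * M"] Suc assms(1)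
    by (simp add: bij_betw_def)
  moreover have "int p dvd a \<and> int p dvd b" if "(a, b) \<in> norm_reps (int p ^ 2 * (int p ^ (2 * k + 1) * M))" for a b
    using that by (intro inert_dvd assms) (simp add: norm_reps_def power2_eq_square)
  ultimately show ?case
    unfolding eq by blast
qed

text \<open>With \<open>\<pi> = u + v \<surd>-3\<close> of norm \<open>p\<close>, the pair \<open>(a, b)\<close> stands for \<open>\<alpha> = a + b \<surd>-3\<close> and the two
  divisibilities say that \<open>\<pi>\<close> divides \<open>\<alpha>\<close>; the maps below are multiplication by \<open>\<pi>\<close> and division.\<close>

lemma bij_betw_norm_reps_split:
  fixes p u v M :: int
  assumes p: "p = u ^ 2 + 3 * v ^ 2" "p \<noteq> 0"
  shows "bij_betw (\<lambda>(c, d). (u * c - 3 * v * d, u * d + v * c)) (norm_reps M)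
    {(a, b) \<in> norm_reps (p * M). p dvd u * a + 3 * v * b \<and> p dvd u * b - v * a}"
proof (rule bij_betw_byWitness[where f' = "\<lambda>(a, b). ((u * a + 3 * v * b) div p, (u * b - v * a) div p)"])
  \<comment> \<open>Multiplying by the conjugate \<open>u - v \<surd>-3\<close> recovers
    \<open>p\<close> times the original pair.\<close>
  have e: "u * (u * c - 3 * v * d) + 3 * v * (u * d + v * c) = p * c"
    "u * (u * d + v * c) - v * (u * c - 3 * v * d) = p * d" for c d
    unfolding p(1) by (simp_all add: power2_eq_square algebra_simps)
  show "\<forall>x\<in>norm_reps M. (case (case x of (c, d) \<Rightarrow> (u * c - 3 * v * d, u * d + v * c)) of
      (a, b) \<Rightarrow> ((u * a + 3 * v * b) div p, (u * b - v * a) div p)) = x"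
    using p(2) by (auto simp: e)
  have n1: "(u * c - 3 * v * d) ^ 2 + 3 * (u * d + v * c) ^ 2 = p * (c ^ 2 + 3 * d ^ 2)" for c d
    unfolding p(1) by (simp add: power2_eq_square algebra_simps)
  show "(\<lambda>(c, d). (u * c - 3 * v * d, u * d + v * c)) ` norm_reps M
    \<subseteq> {(a, b) \<in> norm_reps (p * M). p dvd u * a + 3 * v * b \<and> p dvd u * b - v * a}"
    by (auto simp: norm_reps_def n1 e)
  have inverse_map: "u * c - 3 * v * d = a \<and> u * d + v * c = b \<and> (c, d) \<in> norm_reps M"
    if "(a, b) \<in> norm_reps (p * M)" "u * a + 3 * v * b = p * c" "u * b - v * a = p * d" for a b c d
  proof -
    have "p * (u * c - 3 * v * d) = u * (p * c) - 3 * v * (p * d)"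
      by (simp add: algebra_simps)
    also have "\<dots> = p * a"
      unfolding that(2,3)[symmetric] unfolding p(1) by (simp add: power2_eq_square algebra_simps)
    finally have 1: "p * (u * c - 3 * v * d) = p * a" .
    have "p * (u * d + v * c) = u * (p * d) + v * (p * c)"
      by (simp add: algebra_simps)
    also have "\<dots> = p * b"
      unfolding that(2,3)[symmetric] unfolding p(1) by (simp add: power2_eq_square algebra_simps)
    finally have "p * (u * d + v * c) = p * b" .
    with 1 have ab: "u * c - 3 * v * d = a" "u * d + v * c = b"
      using p(2) by auto
    then have "p * (c ^ 2 + 3 * d ^ 2) = p * M"
      using that(1) n1[of c d] by (simp only: norm_reps_def mem_Collect_eq case_prod_conv)
    then show ?thesis
      using ab p(2) by (simp add: norm_reps_def)
  qed
  show "\<forall>x\<in>{(a, b) \<in> norm_reps (p * M). p dvd u * a + 3 * v * b \<and> p dvd u * b - v * a}.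
    (case (case x of (a, b) \<Rightarrow> ((u * a + 3 * v * b) div p, (u * b - v * a) div p)) of
      (c, d) \<Rightarrow> (u * c - 3 * v * d, u * d + v * c)) = x"
    using inverse_map by auto
  show "(\<lambda>(a, b). ((u * a + 3 * v * b) div p, (u * b - v * a) div p)) `
      {(a, b) \<in> norm_reps (p * M). p dvd u * a + 3 * v * b \<and> p dvd u * b - v * a} \<subseteq> norm_reps M"
    using inverse_map by auto
qed

text \<open>Inclusion-exclusion over the multiples of \<open>u + v \<surd>-3\<close> and of its
  conjugate. Each element of norm \<open>p * M\<close> is a multiple of at least one, and of both
  exactly when \<open>p\<close> divides it.\<close>

lemma card_norm_reps_split:
  fixes p u v M :: int
  assumes "prime p" and p: "p = u ^ 2 + 3 * v ^ 2" and u: "\<not> p dvd 2 * u"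
  shows "card (norm_reps (p * M)) + card {(a, b) \<in> norm_reps (p * M). p dvd a \<and> p dvd b} = 2 * card (norm_reps M)"
proof -
  define A where "A = {(a, b) \<in> norm_reps (p * M). p dvd u * a + 3 * v * b \<and> p dvd u * b - v * a}"
  define B where "B = {(a, b) \<in> norm_reps (p * M). p dvd u * a + 3 * (- v) * b \<and> p dvd u * b - (- v) * a}"
  have p0: "p \<noteq> 0" using assms(1) by auto
  have "card A = card (norm_reps M)"
    unfolding A_def by (rule bij_betw_same_card[OF bij_betw_norm_reps_split[OF p p0], symmetric])
  moreover have "card B = card (norm_reps M)"
    unfolding B_def by (rule bij_betw_same_card[OF bij_betw_norm_reps_split, symmetric]) (use p p0 in simp_all)
  moreover have "A \<inter> B = {(a, b) \<in> norm_reps (p * M). p dvd a \<and> p dvd b}"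
  proof -
    have "p dvd a \<and> p dvd b" if "(a, b) \<in> A" "(a, b) \<in> B" for a b
    proof -
      \<comment> \<open>Adding the two conditions isolates \<open>2 * u * a\<close> and
        \<open>2 * u * b\<close>, where \<open>2 * u\<close> is prime to \<open>p\<close>.\<close>
      have "p dvd (u * a + 3 * v * b) + (u * a + 3 * (- v) * b)" "p dvd (u * b - v * a) + (u * b - (- v) * a)"
        using that unfolding A_def B_def by (blast intro: dvd_add)+
      then have "p dvd (2 * u) * a" "p dvd (2 * u) * b"
        by (simp_all add: algebra_simps)
      with u assms(1) show ?thesis
        by (meson prime_dvd_multD)
    qed
    moreover have "(a, b) \<in> A \<and> (a, b) \<in> B" if "(a, b) \<in> norm_reps (p * M)" "p dvd a" "p dvd b" for a b
      using that unfolding A_def B_def by (simp add: dvd_add dvd_diff)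
    moreover have "A \<subseteq> norm_reps (p * M)"
      by (auto simp: A_def)
    ultimately show ?thesis
      by blast
  qed
  moreover have "A \<union> B = norm_reps (p * M)"
  proof -
    have "(a, b) \<in> A \<union> B" if ab: "(a, b) \<in> norm_reps (p * M)" for a b
    proof -
      have norm: "a ^ 2 + 3 * b ^ 2 = p * M"
        using ab by (simp add: norm_reps_def)
      \<comment> \<open>By multiplicativity of the norm, divisibility of the second coordinate
        forces that of the first.\<close>
      have in1: "p dvd u * a + 3 * w * b" if "p dvd u * b - w * a" "w ^ 2 = v ^ 2" for w
      proof -
        have "(u * a + 3 * w * b) ^ 2 + 3 * (u * b - w * a) ^ 2 = (u ^ 2 + 3 * w ^ 2) * (a ^ 2 + 3 * b ^ 2)"
          by (simp add: power2_eq_square algebra_simps)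
        also have "\<dots> = p * (p * M)"
          using that p norm by simp
        finally have "(u * a + 3 * w * b) ^ 2 = p * (p * M) - 3 * (u * b - w * a) ^ 2"
          by simp
        moreover have "p dvd \<dots>"
          using that(1) by (intro dvd_diff) (auto simp: power2_eq_square)
        ultimately show ?thesis
          using assms(1) by (metis prime_dvd_power)
      qed
      have "(u * b - v * a) * (u * b - (- v) * a) = (u ^ 2 + 3 * v ^ 2) * b ^ 2 - v ^ 2 * (a ^ 2 + 3 * b ^ 2)"
        by (simp add: power2_eq_square algebra_simps)
      also have "p dvd \<dots>"
        unfolding norm p[symmetric] by (intro dvd_diff) auto
      finally have "p dvd u * b - v * a \<or> p dvd u * b - (- v) * a"
        using assms(1) by (simp only: prime_dvd_mult_iff)
      then show ?thesis
        using in1[of v] in1[of "- v"] ab unfolding A_def B_def by auto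
    qed
    moreover have "A \<union> B \<subseteq> norm_reps (p * M)"
      by (auto simp: A_def B_def)
    ultimately show ?thesis
      by fast
  qed
  moreover from this have "finite A" "finite B"
    using finite_norm_reps[of "p * M"] by (metis finite_Un)+
  ultimately show ?thesis
    using card_Un_Int[of A B] by simp
qed

text \<open>Induction with \<open>card_norm_reps_split\<close> at \<open>p^(2 k + 2) * M\<close>:
  twice a multiple of 4 is the sum of the new count and the previous one. At exponent 1 no pair is
  divisible by \<open>p\<close>.\<close>

lemma eight_dvd_card_norm_reps:
  fixes p u v M :: int
  assumes "prime p" "p = u ^ 2 + 3 * v ^ 2" "\<not> p dvd 2 * u" "\<not> p dvd M"
    and four: "\<And>j. 4 dvd card (norm_reps (p ^ (2 * j) * M))"
  shows "8 dvd card (norm_reps (p ^ (2 * k + 1) * M))"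
proof (induction k)
  case 0
  have "{(a, b) \<in> norm_reps (p * M). p dvd a \<and> p dvd b} = {}"
  proof -
    have False if "a ^ 2 + 3 * b ^ 2 = p * M" "p dvd a" "p dvd b" for a b
    proof -
      have "p * p dvd a * a" "p * p dvd b * b"
        using that by (simp_all add: mult_dvd_mono)
      then have "p * p dvd a * a + 3 * (b * b)"
        by (rule dvd_add[OF _ dvd_mult])
      then have "p * p dvd p * M"
        using that(1) by (simp add: power2_eq_square)
      then show False
        using assms(1,4) by simp
    qed
    then show ?thesis
      by (auto simp: norm_reps_def)
  qed
  then have "card (norm_reps (p * M)) = 2 * card (norm_reps M)"
    using card_norm_reps_split[OF assms(1-3), of M] by (simp only: card.empty add_0_right)
  then show ?case
    using four[of 0] by auto
next
  case (Suc k)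
  have eq: "p * (p ^ (2 * k + 2) * M) = p ^ (2 * Suc k + 1) * M" "p * (p ^ (2 * k + 2) * M) = p ^ 2 * (p ^ (2 * k + 1) * M)"
    by (simp_all add: power2_eq_square)
  have "p \<noteq> 0"
    using assms(1) by auto
  then have "card {(a, b) \<in> norm_reps (p ^ 2 * (p ^ (2 * k + 1) * M)). p dvd a \<and> p dvd b}
      = card (norm_reps (p ^ (2 * k + 1) * M))"
    by (rule bij_betw_same_card[OF bij_betw_norm_reps_scale, symmetric])
  then have "card (norm_reps (p ^ (2 * Suc k + 1) * M)) + card (norm_reps (p ^ (2 * k + 1) * M))
      = 2 * card (norm_reps (p ^ (2 * k + 2) * M))"
    using card_norm_reps_split[OF assms(1-3), of "p ^ (2 * k + 2) * M"]
    by (simp only: eq(1)[symmetric] eq(2))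
  moreover have "8 dvd 2 * card (norm_reps (p ^ (2 * k + 2) * M))"
    using four[of "Suc k"] by auto
  ultimately show ?case
    using Suc by (metis dvd_add_left_iff)
qed

section \<open>Coefficients as representation numbers\<close>

text \<open>Odd \<open>b\<close> fails modulo 4, and \<open>3 dvd a\<close> fails modulo 3. So
  \<open>b / 2\<close> can serve as root of a square and \<open>a\<close> as a pentagonal
  index.\<close>

lemma pos_norm_reps_coord:
  assumes "(a, b) \<in> pos_norm_reps (24 * int L + 13)"
  shows "even b" "\<exists>k. a = \<bar>6 * k + 1\<bar>"
proof -
  have n: "a ^ 2 + 3 * b ^ 2 = 24 * int L + 13" and pos: "a > 0" "b > 0"
    using assms by (auto simp: pos_norm_reps_def)
  have parity: "even (a ^ 2 + 3 * b ^ 2) \<longleftrightarrow> even (24 * int L + 13)"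
    unfolding n ..
  show "even b"
  proof (rule ccontr)
    assume "odd b"
    with parity have "even a" by simp
    with \<open>odd b\<close> obtain c d where "b = 2 * c + 1" "a = 2 * d"
      by (auto elim!: oddE evenE)
    with n have "4 * d ^ 2 + 12 * (c ^ 2 + c) + 3 = 24 * int L + 13"
      by (simp add: power2_eq_square algebra_simps)
    then show False by presburger
  qed
  with parity have a: "odd a" by simp
  have "a mod 3 \<noteq> 0"
  proof
    assume "a mod 3 = 0"
    then obtain e where "a = 3 * e" by auto
    with n have "9 * e ^ 2 + 3 * b ^ 2 = 24 * int L + 13"
      by (simp add: power2_eq_square algebra_simps)
    then show False by presburger
  qed
  with a have "a mod 6 = 1 \<or> a mod 6 = 5"
    by presburger
  then show "\<exists>k. a = \<bar>6 * k + 1\<bar>"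
  proof
    assume "a mod 6 = 1"
    then have "6 * (a div 6) + 1 = a" using mult_div_mod_eq[of 6 a] by linarith
    then have "a = \<bar>6 * (a div 6) + 1\<bar>" using pos by linarith
    then show ?thesis ..
  next
    assume "a mod 6 = 5"
    then have "6 * (- (a div 6) - 1) + 1 = - a" by presburger
    then have "a = \<bar>6 * (- (a div 6) - 1) + 1\<bar>" using pos by linarith
    then show ?thesis ..
  qed
qed

text \<open>Completing the square, \<open>12 k (3 k + 1) + 1 = (6 k + 1)^2\<close>, turns
  \<open>4 L + 2 = 2 j^2 + 2 k (3 k + 1)\<close> into
  \<open>24 L + 13 = (6 k + 1)^2 + 3 (2 j)^2\<close>.\<close>

lemma card_pentagonal_eq_card_fibre:
  assumes "j > 0" "2 * j ^ 2 \<le> 4 * L + 2"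
  shows "card {k::int. int (4 * L + 2 - 2 * j ^ 2) = 2 * (k * (3 * k + 1))}
    = card {(a, b) \<in> pos_norm_reps (24 * int L + 13). b ^ 2 = 2 * int (2 * j ^ 2)}"
proof (rule bij_betw_same_card[of "\<lambda>k. (\<bar>6 * k + 1\<bar>, 2 * int j)"], rule bij_betw_imageI)
  show "inj_on (\<lambda>k. (\<bar>6 * k + 1\<bar>, 2 * int j)) {k. int (4 * L + 2 - 2 * j ^ 2) = 2 * (k * (3 * k + 1))}"
  proof (rule inj_onI)
    fix k l :: int
    assume "(\<bar>6 * k + 1\<bar>, 2 * int j) = (\<bar>6 * l + 1\<bar>, 2 * int j)"
    then have "\<bar>6 * k + 1\<bar> = \<bar>6 * l + 1\<bar>"
      by simp
    then show "k = l" by presburger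
  qed
  have iff: "int (4 * L + 2 - 2 * j ^ 2) = 2 * (k * (3 * k + 1)) \<longleftrightarrow> (6 * k + 1) ^ 2 + 3 * (2 * int j) ^ 2 = 24 * int L + 13" for k
  proof -
    have "int (4 * L + 2 - 2 * j ^ 2) = 4 * int L + 2 - 2 * int j ^ 2"
      using assms(2) by (simp add: of_nat_diff)
    moreover have "(6 * k + 1) ^ 2 = 12 * (k * (3 * k + 1)) + 1" "(2 * int j) ^ 2 = 4 * int j ^ 2"
      by (simp_all add: power2_eq_square algebra_simps)
    ultimately show ?thesis by linarith
  qed
  have b: "b = 2 * int j" if "b ^ 2 = 2 * int (2 * j ^ 2)" "b > 0" for b
  proof -
    have "b ^ 2 = (2 * int j) ^ 2"
      using that by (simp add: power_mult_distrib)
    then show ?thesis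
      by (rule power2_eq_imp_eq) (use that in simp_all)
  qed
  have in_iff: "(\<bar>6 * k + 1\<bar>, 2 * int j) \<in> pos_norm_reps (24 * int L + 13)
      \<longleftrightarrow> int (4 * L + 2 - 2 * j ^ 2) = 2 * (k * (3 * k + 1))" for k
  proof -
    have "6 * k + 1 \<noteq> 0" by presburger
    then show ?thesis
      unfolding iff pos_norm_reps_def using assms(1) by simp
  qed
  show "(\<lambda>k. (\<bar>6 * k + 1\<bar>, 2 * int j)) ` {k. int (4 * L + 2 - 2 * j ^ 2) = 2 * (k * (3 * k + 1))}
      = {(a, b) \<in> pos_norm_reps (24 * int L + 13). b ^ 2 = 2 * int (2 * j ^ 2)}" (is "?l = ?r")
  proof
    show "?l \<subseteq> ?r"
      unfolding in_iff[symmetric] by (auto simp: power_mult_distrib)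
    show "?r \<subseteq> ?l"
    proof clarify
      fix a c assume ac: "(a, c) \<in> pos_norm_reps (24 * int L + 13)" "c ^ 2 = 2 * int (2 * j ^ 2)"
      then have c: "c = 2 * int j"
        by (intro b) (auto simp: pos_norm_reps_def)
      obtain k where "a = \<bar>6 * k + 1\<bar>"
        using pos_norm_reps_coord(2)[OF ac(1)] by blast
      with ac(1) c show "(a, c) \<in> ?l"
        unfolding in_iff[symmetric] by blast
    qed
  qed
qed

lemma finite_pos_norm_reps: "finite (pos_norm_reps M)"
  by (rule finite_subset[OF _ finite_norm_reps[of M]]) (auto simp: pos_norm_reps_def norm_reps_def)

text \<open>Sorts the pairs by the exponent \<open>i = b^2 / 2\<close> that the divisor series
  contributes to the convolution.\<close>

lemma card_pos_norm_reps_eq_sum: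
  "card (pos_norm_reps (24 * int L + 13)) =
    (\<Sum>i\<le>4 * L + 2. card {(a, b) \<in> pos_norm_reps (24 * int L + 13). b ^ 2 = 2 * int i})"
proof -
  let ?P = "pos_norm_reps (24 * int L + 13)"
  have "?P = (\<Union>i\<in>{..4 * L + 2}. {(a, b) \<in> ?P. b ^ 2 = 2 * int i})"
  proof -
    have "\<exists>i\<le>4 * L + 2. b ^ 2 = 2 * int i" if ab: "(a, b) \<in> ?P" for a b
    proof -
      obtain c where c: "b = 2 * c"
        using pos_norm_reps_coord(1)[OF ab] by (elim evenE)
      have "b ^ 2 = 2 * int (nat (2 * c ^ 2))"
        by (simp add: c power_mult_distrib)
      moreover have "a ^ 2 + 3 * (4 * c ^ 2) = 24 * int L + 13"
        using ab by (simp add: c pos_norm_reps_def power_mult_distrib)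
      then have "nat (2 * c ^ 2) \<le> 4 * L + 2"
        using zero_le_power2[of a] by linarith
      ultimately show ?thesis by blast
    qed
    then show ?thesis by fastforce
  qed
  also have "card \<dots> = (\<Sum>i\<le>4 * L + 2. card {(a, b) \<in> ?P. b ^ 2 = 2 * int i})"
    by (rule card_UN_disjoint) (auto intro: finite_subset[OF _ finite_pos_norm_reps])
  finally show ?thesis .
qed

lemma EO_u_mod_4: "[EO_u (4 * L + 2) = 2 * int (card (pos_norm_reps (24 * int L + 13)))] (mod 4)"
proof -
  let ?n = "4 * L + 2"
  let ?F = "\<lambda>e. card {k::int. int e = 2 * (k * (3 * k + 1))}"
  \<comment> \<open>The exponents \<open>2 k (3 k + 1)\<close> in \<open>f_4\<close> are multiples
    of 4, so the summand 1 of the second factor contributes nothing.\<close>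
  have F0: "fps_nth (euler_f 4) ?n = 0"
  proof -
    have "?n \<noteq> 2 * nat (k * (3 * k + 1))" for k :: int
    proof
      assume "?n = 2 * nat (k * (3 * k + 1))"
      then have "k * (3 * k + 1) = 2 * int L + 1"
        by linarith
      then have "odd (k * (3 * k + 1))" by simp
      then show False by simp
    qed
    then show ?thesis
      using euler_f_even_nth[of 2 ?n ?n] by simp
  qed
  have summand: "[fps_nth (divisors_gf 2) i * fps_nth (euler_f 4) (?n - i)
      = int (card {(a, b) \<in> pos_norm_reps (24 * int L + 13). b ^ 2 = 2 * int i})] (mod 2)"
    if "i \<le> ?n" for i
  proof -
    have "[fps_nth (divisors_gf 2) i * fps_nth (euler_f 4) (?n - i)
        = of_bool (i > 0 \<and> (\<exists>j. i = 2 * j ^ 2)) * int (?F (?n - i))] (mod 2)"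
      using euler_f_even_nth_cong_2[of 2 "?n - i"]
      by (intro cong_mult divisors_gf_2_nth_cong_2) simp
    also have "of_bool (i > 0 \<and> (\<exists>j. i = 2 * j ^ 2)) * int (?F (?n - i))
        = int (card {(a, b) \<in> pos_norm_reps (24 * int L + 13). b ^ 2 = 2 * int i})"
    proof (cases "i > 0 \<and> (\<exists>j. i = 2 * j ^ 2)")
      case True
      then obtain j where "i = 2 * j ^ 2" "j > 0" by auto
      then show ?thesis
        using card_pentagonal_eq_card_fibre[of j L] that by auto
    next
      case False
      \<comment> \<open>As \<open>b\<close> is even and positive, a nonempty fibre would make
        \<open>i\<close> twice a positive square.\<close>
      have "{(a, b) \<in> pos_norm_reps (24 * int L + 13). b ^ 2 = 2 * int i} = {}"
      proof -
        have "i > 0 \<and> (\<exists>j. i = 2 * j ^ 2)"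
          if ab: "(a, b) \<in> pos_norm_reps (24 * int L + 13)" "b ^ 2 = 2 * int i" for a b
        proof -
          obtain c where c: "b = 2 * c"
            using pos_norm_reps_coord(1)[OF ab(1)] by (elim evenE)
          then have "int i = 2 * c ^ 2" "c > 0"
            using ab by (auto simp: power_mult_distrib pos_norm_reps_def)
          then have "i = 2 * nat c ^ 2" "i > 0"
            by (auto simp: nat_power_eq[symmetric] intro!: gr0I)
          then show ?thesis by blast
        qed
        with False show ?thesis by blast
      qed
      then have "card {(a, b) \<in> pos_norm_reps (24 * int L + 13). b ^ 2 = 2 * int i} = 0"
        by (simp only: card.empty)
      with False show ?thesis by simp
    qed
    finally show ?thesis .
  qed
  have "4 dvd fps_nth (EO_u_gf - euler_f 4 * (1 + 2 * divisors_gf 2)) ?n"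
    using EO_u_gf_mod_4 unfolding four_dvd_fps_iff by blast
  then have "[EO_u ?n = fps_nth (euler_f 4 * (1 + 2 * divisors_gf 2)) ?n] (mod 4)"
    by (simp add: EO_u_def cong_iff_dvd_diff)
  also have "euler_f 4 * (1 + 2 * divisors_gf 2) = euler_f 4 + fps_const 2 * (divisors_gf 2 * euler_f 4)"
    by (simp add: fps_numeral_fps_const[symmetric] algebra_simps)
  also have "fps_nth \<dots> ?n = 2 * (\<Sum>i\<le>?n. fps_nth (divisors_gf 2) i * fps_nth (euler_f 4) (?n - i))"
    by (simp only: fps_add_nth F0 fps_mult_left_const_nth add_0) (simp only: fps_mult_nth atMost_atLeast0)
  also have "[\<dots> = 2 * int (card (pos_norm_reps (24 * int L + 13)))] (mod 4)"
  proof -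
    have "[(\<Sum>i\<le>?n. fps_nth (divisors_gf 2) i * fps_nth (euler_f 4) (?n - i))
        = int (card (pos_norm_reps (24 * int L + 13)))] (mod 2)"
      unfolding card_pos_norm_reps_eq_sum of_nat_sum using summand by (intro cong_sum) simp
    then have "2 * 2 dvd 2 * ((\<Sum>i\<le>?n. fps_nth (divisors_gf 2) i * fps_nth (euler_f 4) (?n - i))
        - int (card (pos_norm_reps (24 * int L + 13))))"
      unfolding cong_iff_dvd_diff by (rule mult_dvd_mono[OF dvd_refl])
    then show ?thesis
      by (simp add: cong_iff_dvd_diff right_diff_distrib)
  qed
  finally show ?thesis .
qed

section \<open>The progressions\<close>

lemma pos_norm_reps_inert:
  fixes p :: nat and M :: int
  assumes "prime p" "p mod 3 = 2" "p \<noteq> 2" "\<not> int p dvd M"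
  shows "pos_norm_reps (int p ^ (2 * k + 1) * M) = {}"
  using norm_reps_inert[OF assms, of k] by (auto simp: norm_reps_def pos_norm_reps_def)

text \<open>Such \<open>M\<close> is 3 modulo 4 or 5 modulo 8, hence no square, and 1 modulo 3,
  hence not 3 times a square.\<close>

lemma card_norm_reps_mod_12:
  assumes "M mod 12 = 7 \<or> M mod 24 = 13"
  shows "card (norm_reps M) = 4 * card (pos_norm_reps M)"
proof (rule card_norm_reps)
  fix a :: int
  have "(a mod 8) ^ 2 mod 8 \<in> {0, 1, 4}"
  proof -
    have "a mod 8 \<in> {0, 1, 2, 3, 4, 5, 6, 7}"
      by (simp; presburger)
    then show ?thesis by auto
  qed
  then have "a ^ 2 mod 8 \<in> {0, 1, 4}"
    by (simp add: mod_simps)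
  then show "M \<noteq> a ^ 2"
    using assms mod_mod_cancel[of 4 8 M] mod_mod_cancel[of 4 12 M] mod_mod_cancel[of 8 24 M] by auto
  have "M mod 3 = 1"
    using assms mod_mod_cancel[of 3 12 M] mod_mod_cancel[of 3 24 M] by auto
  then show "M \<noteq> 3 * a ^ 2"
    by auto
qed

text \<open>Even powers of \<open>p\<close> are 1 modulo 24, so all the numbers involved are
  nondegenerate and the factor 4 for signs cancels from the divisibility by 8.\<close>

lemma even_card_pos_norm_reps_split:
  fixes p u v M :: int
  assumes "prime p" "p = u ^ 2 + 3 * v ^ 2" "\<not> p dvd 2 * u" "\<not> p dvd M"
    and p2: "p ^ 2 mod 24 = 1" and M: "M mod 12 = 7" "p * M mod 24 = 13"
  shows "even (card (pos_norm_reps (p ^ (2 * k + 1) * M)))"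
proof -
  have sq: "p ^ (2 * j) mod 24 = 1" for j
  proof -
    have "(p ^ 2) ^ j mod 24 = (p ^ 2 mod 24) ^ j mod 24"
      by (simp only: power_mod)
    then show ?thesis
      by (simp add: p2 power_mult)
  qed
  have "p ^ (2 * j) * M mod 12 = 7" for j
  proof -
    have "p ^ (2 * j) mod 12 = 1"
      using sq[of j] mod_mod_cancel[of 12 24 "p ^ (2 * j)"] by simp
    then show ?thesis
      using M(1) mod_mult_eq[of "p ^ (2 * j)" 12 M] by simp
  qed
  then have "4 dvd card (norm_reps (p ^ (2 * j) * M))" for j
    using card_norm_reps_mod_12 by simp
  then have "8 dvd card (norm_reps (p ^ (2 * k + 1) * M))"
    by (rule eight_dvd_card_norm_reps[OF assms(1-4)])
  moreover have "p ^ (2 * k + 1) * M mod 24 = 13"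
  proof -
    have "p ^ (2 * k) * (p * M) mod 24 = 13"
      using sq[of k] M(2) mod_mult_eq[of "p ^ (2 * k)" 24 "p * M"] by simp
    then show ?thesis by (simp add: mult_ac)
  qed
  ultimately have "4 * 2 dvd 4 * card (pos_norm_reps (p ^ (2 * k + 1) * M))"
    using card_norm_reps_mod_12 by simp
  then show ?thesis by simp
qed

text \<open>The fraction in the index is \<open>4 c + 2\<close>, where \<open>c\<close> starts at
  \<open>r\<close> and obeys \<open>c \<mapsto> p^2 c + p m + r\<close>; the first hypothesis makes
  each such step multiply \<open>24 c + 13\<close> by \<open>p^2\<close>.\<close>

lemma index_closed_form:
  fixes p r m t k :: nat
  assumes "24 * (p * m + r) = 13 * (p ^ 2 - 1)" "p * t = 24 * r + 13" "p > 1"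
  shows "\<exists>c. (p ^ 2 - 1) * c + p * m + r = p ^ (2 * k + 2) * r + p ^ (2 * k + 1) * m
    \<and> 24 * c + 13 = p ^ (2 * k + 1) * t"
proof -
  define q where "q = p ^ 2 - 1"
  have q: "p ^ 2 = q + 1" using assms(3) by (simp add: q_def)
  have "\<exists>c. q * c + p * m + r = p ^ (2 * k + 2) * r + p ^ (2 * k + 1) * m
    \<and> 24 * c + 13 = p ^ (2 * k + 1) * t"
  proof (induction k)
    case 0
    have "q * r + p * m + r = p ^ 2 * r + p * m"
      unfolding q by simp
    with assms(2) show ?case
      by (intro exI[of _ r]) (simp only: mult_0_right add_0 power_one_right)
  next
    case (Suc k)
    then obtain c where c: "q * c + p * m + r = p ^ (2 * k + 2) * r + p ^ (2 * k + 1) * m"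
      "24 * c + 13 = p ^ (2 * k + 1) * t"
      by blast
    have s: "p ^ (2 * Suc k + 2) = p ^ 2 * p ^ (2 * k + 2)" "p ^ (2 * Suc k + 1) = p ^ 2 * p ^ (2 * k + 1)"
      by (simp_all add: power2_eq_square)
    have "q * (p ^ 2 * c + p * m + r) + p * m + r = p ^ 2 * (q * c + p * m + r)"
      unfolding q by (simp add: algebra_simps)
    also have "\<dots> = p ^ (2 * Suc k + 2) * r + p ^ (2 * Suc k + 1) * m"
      unfolding s c(1) by (simp add: algebra_simps)
    finally have 1: "q * (p ^ 2 * c + p * m + r) + p * m + r
      = p ^ (2 * Suc k + 2) * r + p ^ (2 * Suc k + 1) * m" .
    have "24 * (p ^ 2 * c + p * m + r) + 13 = p ^ 2 * (24 * c) + 24 * (p * m + r) + 13"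
      by (simp add: algebra_simps)
    also have "\<dots> = p ^ 2 * (24 * c + 13)"
      unfolding assms(1) q_def[symmetric] unfolding q by (simp add: algebra_simps)
    also have "\<dots> = p ^ (2 * Suc k + 1) * t"
      unfolding s c(2) by simp
    finally show ?case
      using 1 by blast
  qed
  then show ?thesis
    unfolding q_def .
qed

text \<open>Exponents \<open>2 k + 2\<close> and \<open>2 k + 1\<close> stand for \<open>2 k\<close>
  and \<open>2 k - 1\<close> with \<open>k\<close> shifted by one. Here \<open>N = 4 L + 2\<close>,
  and the task is to show that \<open>p\<close> divides \<open>24 L + 13\<close> to an odd
  power.\<close>

lemma EO_u_cong_0_mod_4:
  fixes p r m t s n k :: nat
  assumes "prime p" "p > 3"
    and r: "24 * (p * m + r) = 13 * (p ^ 2 - 1)" and t: "p * t = 24 * r + 13"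
    and s: "s < p" "m < p" "s \<noteq> m"
    and residue: "p mod 3 = 2 \<or>
      (\<exists>u. int p = u ^ 2 + 3 \<and> \<not> int p dvd 2 * u) \<and> p ^ 2 mod 24 = 1 \<and> t mod 12 = 7 \<and> p * t mod 24 = 13"
  shows "\<exists>N :: nat.
    real N = 4 * real p ^ (2 * k + 2) * real n + 4 * real p ^ (2 * k + 1) * real s
      + (4 * real p ^ (2 * k + 2) * real r + 4 * real p ^ (2 * k + 1) * real m
          + 2 * real p ^ 2 - 4 * real p * real m - 4 * real r - 2) / (real p ^ 2 - 1)
    \<and> [EO_u N = 0] (mod 4)"
proof -
  have p1: "p > 1" using assms(2) by simp
  obtain c where c: "(p ^ 2 - 1) * c + p * m + r = p ^ (2 * k + 2) * r + p ^ (2 * k + 1) * m"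
    "24 * c + 13 = p ^ (2 * k + 1) * t"
    using index_closed_form[OF r t p1] by blast
  define L where "L = p ^ (2 * k + 2) * n + p ^ (2 * k + 1) * s + c"
  define M where "M = 24 * p * n + 24 * s + t"
  have "24 * L + 13 = p ^ (2 * k + 1) * M"
    unfolding L_def M_def using c(2) by (simp add: algebra_simps)
  then have L: "24 * int L + 13 = int p ^ (2 * k + 1) * int M"
    by (metis of_nat_add of_nat_mult of_nat_numeral of_nat_power)
  have "p ^ 2 \<ge> 1"
    using p1 by simp
  \<comment> \<open>The resulting \<open>24 m + t = 13 p\<close> gives \<open>M\<close> congruent to
    \<open>24 (s - m)\<close> modulo \<open>p\<close>; this is where \<open>s \<noteq> m\<close>
    enters.\<close>
  have "p * (24 * m + t) = 24 * (p * m + r) + 13"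
    using t by (simp add: algebra_simps)
  also have "\<dots> = 13 * p ^ 2"
    unfolding r using \<open>p ^ 2 \<ge> 1\<close> by linarith
  also have "\<dots> = p * (13 * p)"
    by (simp add: power2_eq_square)
  finally have mt: "24 * m + t = 13 * p"
    using p1 by simp
  have ndvd: "\<not> int p dvd int M"
  proof
    assume "int p dvd int M"
    then have "int p dvd int M - (24 * int p * int n + int (24 * m + t))"
      unfolding mt by (intro dvd_diff) simp_all
    also have "int M - (24 * int p * int n + int (24 * m + t)) = 24 * (int s - int m)"
      by (simp add: M_def)
    finally have "int p dvd 24 * (int s - int m)" .
    moreover have "coprime (int p) 24"
    proof -
      have "\<not> p dvd 2" "\<not> p dvd 3"
        using assms(2) by (auto dest: dvd_imp_le)
      then have "coprime p 2" "coprime p 3"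
        using assms(1) prime_imp_coprime by blast+
      then have "coprime p (2 ^ 3 * 3)"
        unfolding coprime_mult_right_iff coprime_power_right_iff by blast
      then have "coprime p 24"
        by simp
      then have "coprime (int p) (int 24)"
        unfolding coprime_int_iff by simp
      then show ?thesis
        by simp
    qed
    ultimately have "int p dvd int s - int m"
      by (simp only: coprime_dvd_mult_right_iff)
    moreover have "0 < \<bar>int s - int m\<bar>" "\<bar>int s - int m\<bar> < int p"
      using s by auto
    ultimately show False
      using zdvd_not_zless dvd_abs_iff by blast
  qed
  have "even (card (pos_norm_reps (24 * int L + 13)))"
  proof (cases "p mod 3 = 2")
    case True
    then show ?thesis
      unfolding L using pos_norm_reps_inert[of p "int M" k] assms(1,2) ndvd by simp
  next
    case False
    with residue obtain u where u: "int p = u ^ 2 + 3 * 1 ^ 2" "\<not> int p dvd 2 * u"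
      and res: "p ^ 2 mod 24 = 1" "t mod 12 = 7" "p * t mod 24 = 13"
      by auto
    have "M = 12 * (2 * (p * n + s)) + t"
      by (simp add: M_def algebra_simps)
    then have "M mod 12 = 7"
      using res(2) by (simp only: mod_mult_self4)
    moreover have "p * M = 24 * (p * (p * n + s)) + p * t"
      by (simp add: M_def algebra_simps)
    then have "p * M mod 24 = 13"
      using res(3) by (simp only: mod_mult_self4)
    ultimately have "int (p ^ 2 mod 24) = 1" "int (M mod 12) = 7" "int (p * M mod 24) = 13"
      using res(1) by simp_all
    then have "int p ^ 2 mod 24 = 1" "int M mod 12 = 7" "int p * int M mod 24 = 13"
      by (simp_all add: zmod_int)
    then show ?thesis
      unfolding L using even_card_pos_norm_reps_split[OF _ u ndvd] assms(1) by simp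
  qed
  then have "[2 * int (card (pos_norm_reps (24 * int L + 13))) = 0] (mod 4)"
    by (auto simp: cong_0_iff elim!: evenE)
  then have "[EO_u (4 * L + 2) = 0] (mod 4)"
    by (rule cong_trans[OF EO_u_mod_4])
  moreover have "real (4 * L + 2) = 4 * real p ^ (2 * k + 2) * real n + 4 * real p ^ (2 * k + 1) * real s
      + (4 * real p ^ (2 * k + 2) * real r + 4 * real p ^ (2 * k + 1) * real m
          + 2 * real p ^ 2 - 4 * real p * real m - 4 * real r - 2) / (real p ^ 2 - 1)"
  proof -
    define d where "d = real p ^ 2 - 1"
    have "real p ^ 2 > 1"
      using p1 by simp
    then have "d \<noteq> 0"
      by (simp add: d_def)
    have "real ((p ^ 2 - 1) * c + p * m + r) = real (p ^ (2 * k + 2) * r + p ^ (2 * k + 1) * m)"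
      unfolding c(1) ..
    then have "d * real c + real p * real m + real r = real p ^ (2 * k + 2) * real r + real p ^ (2 * k + 1) * real m"
      using \<open>p ^ 2 \<ge> 1\<close> by (simp only: d_def of_nat_add of_nat_mult of_nat_power of_nat_diff of_nat_1)
    then have "4 * real p ^ (2 * k + 2) * real r + 4 * real p ^ (2 * k + 1) * real m
          + 2 * real p ^ 2 - 4 * real p * real m - 4 * real r - 2 = (4 * real c + 2) * d"
      unfolding d_def by (simp only: algebra_simps)
    then show ?thesis
      unfolding d_def[symmetric] using \<open>d \<noteq> 0\<close> by (simp add: L_def del: power_Suc)
  qed
  ultimately show ?thesis
    by blast
qed

text \<open>The index is computed over the reals; the existence of a natural \<open>N\<close>
  includes the claim that the fraction yields an integer.\<close>

theorem corollary4p1: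
  fixes p r m s n k :: nat
  assumes "(p, r, m) \<in> {(5, 3, 2), (7, 5, 3), (11, 10, 5), (17, 3, 9), (19, 5, 10),
                         (23, 10, 12), (29, 20, 15)}"
    and "s < p" and "s \<noteq> m" and "k \<ge> 1"
  shows "\<exists>N :: nat.
    real N = 4 * real p ^ (2 * k) * real n + 4 * real p ^ (2 * k - 1) * real s
      + (4 * real p ^ (2 * k) * real r + 4 * real p ^ (2 * k - 1) * real m
          + 2 * real p ^ 2 - 4 * real p * real m - 4 * real r - 2) / (real p ^ 2 - 1)
    \<and> [EO_u N = 0] (mod 4)"
proof -
  obtain j where k: "k = Suc j"
    using assms(4) by (cases k) auto
  have prime: "prime (7::nat)" "prime (11::nat)" "prime (17::nat)" "prime (19::nat)" "prime (23::nat)" "prime (29::nat)" "prime (5::nat)"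
    by simp_all
  have "prime p"
    using assms(1) prime by auto
  moreover have "p > 3" "24 * (p * m + r) = 13 * (p ^ 2 - 1)" "m < p"
    using assms(1) by auto
  moreover have "p * ((24 * r + 13) div p) = 24 * r + 13"
    using assms(1) by auto
  moreover have "p mod 3 = 2 \<or>
      (\<exists>u. int p = u ^ 2 + 3 \<and> \<not> int p dvd 2 * u) \<and> p ^ 2 mod 24 = 1
        \<and> (24 * r + 13) div p mod 12 = 7 \<and> p * ((24 * r + 13) div p) mod 24 = 13"
  proof -
    \<comment> \<open>The split primes are \<open>7 = 2^2 + 3\<close> and
      \<open>19 = 4^2 + 3\<close>; the other five are 2 modulo 3.\<close>
    have "\<exists>u::int. 7 = u ^ 2 + 3 \<and> \<not> 7 dvd 2 * u" "\<exists>u::int. 19 = u ^ 2 + 3 \<and> \<not> 19 dvd 2 * u"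
      by (rule exI[of _ 2], simp, rule exI[of _ 4], simp)
    then show ?thesis
      using assms(1) by auto
  qed
  ultimately show ?thesis
    using EO_u_cong_0_mod_4[of p m r "(24 * r + 13) div p" s j n] assms(2,3) by (simp add: k)
qed

end
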